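(* Take any function $\mathsf s\colon[0,\infty]\to[-\infty,\infty]$. Then the following two conditions are equivalent to each other: (I) there exists a function $\mathsf r\colon[-\infty,\infty]\to[-\infty,\infty]$ such that the restriction of $\mathsf r$ to $[0,\infty]$ equals $\mathsf s$ and $\mathsf r=\mathsf r_\mu$ for some non-atomic zero-mean probability measure $\mu$ on $\mathcal B(\mathbb R)$; (II) all of the following conditions hold: - $\mathsf s(0)=0$; - $\mathsf s$ is nonincreasing on $[0,\infty]$; - $\mathsf s$ is left-continuous on $(0,\infty]$; - if $0\le x<y\le\infty$ and $\mathsf s(x+)<\mathsf s(x)$, then $\mathsf s(y)<\mathsf s(x+)$. Moreover, under condition (II), the function $\mathsf r$ as in (I) is unique.
   Context: $\mathcal B(\mathbb R)$ is the Borel $\sigma$-algebra on $\mathbb R$. A probability measure $\mu$ on $\mathcal B(\mathbb R)$ is zero-mean if $\int|x|\,\mu(dx)<\infty$ and $\int x\,\mu(dx)=0$. $\mathsf s(x+)$ is the right limit of $\mathsf s$ at $x$. For a non-atomic zero-mean probability measure $\mu$ (extended to $[-\infty,\infty]$ by $\mu(\{\pm\infty\})=0$), define $G\colon[-\infty,\infty]\to[0,\infty)$ by $G(x)=\int_{(0,x]}z\,\mu(dz)$ for $x\in[0,\infty]$ and $G(x)=\int_{[x,0)}(-z)\,\mu(dz)$ for $x\in[-\infty,0]$; let $x_{+}(h)=\inf\{x\in[0,\infty]\colon G(x)\ge h\}$ and $x_{-}(h)=\sup\{x\in[-\infty,0]\colon G(x)\ge h\}$ (with $\inf\emptyset=\infty$,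 $\sup\emptyset=-\infty$). The reciprocating function $\mathsf r_\mu\colon[-\infty,\infty]\to[-\infty,\infty]$ of $\mu$ is $\mathsf r_\mu(x)=x_-(G(x))$ for $x\in[0,\infty]$ and $\mathsf r_\mu(x)=x_+(G(x))$ for $x\in[-\infty,0]$.
   Formalization: The formal theorem assumes s is not identically 0 on [0,∞]; for s ≡ 0 condition (II) holds but (I) fails, because every non-atomic zero-mean probability measure μ has r_μ(∞) < 0. *)

theory Defs
  imports "HOL-Probability.Probability"
begin

definition zero_mean_prob :: "real measure \<Rightarrow> bool" where
  "zero_mean_prob \<mu> \<longleftrightarrow>
     prob_space \<mu> \<and> sets \<mu> = sets borel \<and>
     integrable \<mu> (\<lambda>x. \<bar>x\<bar>) \<and> (\<integral>x. x \<partial>\<mu>) = 0"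

definition measure_atom :: "'a measure \<Rightarrow> 'a set \<Rightarrow> bool" where
  "measure_atom M A \<longleftrightarrow>
     A \<in> sets M \<and> emeasure M A > 0 \<and>
     (\<forall>B\<in>sets M. B \<subseteq> A \<and> emeasure M B < emeasure M A \<longrightarrow> emeasure M B = 0)"

definition nonatomic :: "'a measure \<Rightarrow> bool" where
  "nonatomic M \<longleftrightarrow> \<not> (\<exists>A. measure_atom M A)"

(* Since the extension of \<mu> to [-\<infinity>, \<infinity>] gives no mass to the points \<plusminus>\<infinity>, the integrals over
   (0, x] and [x, 0) are taken over the real points of these intervals. *)
definition G :: "real measure \<Rightarrow> ereal \<Rightarrow> real" where
  "G \<mu> x = (if 0 \<le> x then (LINT z:{z. 0 < ereal z \<and> ereal z \<le> x}|\<mu>. z)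
                      else (LINT z:{z. x \<le> ereal z \<and> ereal z < 0}|\<mu>. - z))"

(* In the complete lattice ereal, Inf {} = \<infinity> and Sup {} = -\<infinity>. *)
definition x_plus :: "real measure \<Rightarrow> real \<Rightarrow> ereal" where
  "x_plus \<mu> h = Inf {x. 0 \<le> x \<and> G \<mu> x \<ge> h}"

definition x_minus :: "real measure \<Rightarrow> real \<Rightarrow> ereal" where
  "x_minus \<mu> h = Sup {x. x \<le> 0 \<and> G \<mu> x \<ge> h}"

(* At x = 0 the two clauses agree: G \<mu> 0 = 0 and x_minus \<mu> 0 = x_plus \<mu> 0 = 0. *)
definition reciprocating_fun :: "real measure \<Rightarrow> ereal \<Rightarrow> ereal" where
  "reciprocating_fun \<mu> x = (if 0 \<le> x then x_minus \<mu> (G \<mu> x) else x_plus \<mu> (G \<mu> x))"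

(* A function s on [0, \<infinity>] is represented by a function on ereal of which only the values
   on {0..} matter. *)
definition reciprocating_extension :: "(ereal \<Rightarrow> ereal) \<Rightarrow> (ereal \<Rightarrow> ereal) \<Rightarrow> bool" where
  "reciprocating_extension s r \<longleftrightarrow>
     (\<forall>x\<in>{0..}. r x = s x) \<and>
     (\<exists>\<mu>. zero_mean_prob \<mu> \<and> nonatomic \<mu> \<and> r = reciprocating_fun \<mu>)"

(* Lim (at_right x) s is the right limit s(x+); it exists for 0 \<le> x < \<infinity> by monotonicity.
   The function vanishing on all of [0, \<infinity>] satisfies this predicate, but it has no reciprocating
   extension: non-atomicity of \<mu> forces reciprocating_fun \<mu> \<infinity> < 0. *)
definition reciprocating_half :: "(ereal \<Rightarrow> ereal) \<Rightarrow> bool" where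
  "reciprocating_half s \<longleftrightarrow>
     s 0 = 0 \<and>
     antimono_on {0..} s \<and>
     (\<forall>x\<in>{0<..}. (s \<longlongrightarrow> s x) (at_left x)) \<and>
     (\<forall>x y. 0 \<le> x \<and> x < y \<and> Lim (at_right x) s < s x \<longrightarrow> s y < Lim (at_right x) s)"

end

(* Write G = G_mu. It is continuous, and s(y) is the greatest x \<le> 0 with G x = G y; this gives (II).
   For x \<le> 0 \<le> y one has G y < G x iff x < s z < s y for some z \<ge> 0, so the values of r on the
   negative half-line are determined by s.

   Conversely, (II) says that the range of s has no gaps in the order sense, although it may well
   have Lebesgue measure 0, so that mu cannot be taken absolutely continuous in general. An argument as
   in Urysohn's lemma gives a continuous nondecreasing F that increases exactly where s decreases. Let nu
   be the Stieltjes measure of F on the positive half-line, and let w be a positive weight with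
   w(y) \<le> min(y, -s(y)). Then mu is, up to normalisation, the sum of w(y)/y nu(dy) and the image
   under s of w(y)/(-s(y)) nu(dy): the measures |z| mu(dz) on the two half-lines are then w nu and its
   image under s. *)
theory Submission
  imports Defs
begin

section \<open>Reciprocating functions satisfy (II) and are determined on the negative half-line\<close>

lemma at_right_ereal_neq_bot:
  fixes x :: ereal
  assumes "x < \<infinity>"
  shows "at_right x \<noteq> bot"
  using assms by (auto simp: trivial_limit_def eventually_at_right[of x \<infinity>] dest: dense)

text \<open>\<open>Lim\<close> has a usable value only once convergence is known. Combined with
  \<open>at_right_ereal_neq_bot\<close>, this identifies the right limit in (II) with a supremum,
  and both directions of the equivalence work with that supremum.\<close>

lemma tendsto_Sup_at_right:
  fixes s :: "ereal \<Rightarrow> ereal"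
  assumes anti: "antimono_on {x<..} s" and x: "x < \<infinity>"
  shows "(s \<longlongrightarrow> Sup (s ` {x<..})) (at_right x)"
proof (rule order_tendstoI)
  let ?L = "Sup (s ` {x<..})"
  show "\<forall>\<^sub>F z in at_right x. a < s z" if a: "a < ?L" for a
  proof -
    obtain w where w: "x < w" "a < s w" using a by (auto simp: less_Sup_iff)
    have "\<forall>\<^sub>F z in at_right x. z < w \<and> x < z"
      using w(1) eventually_at_right[of x w] by auto
    then show ?thesis
    proof eventually_elim
      case (elim z)
      then have "s w \<le> s z" using w(1) by (intro monotone_onD[OF anti]) auto
      then show ?case by (rule less_le_trans[OF w(2)])
    qed
  qed
  have "\<forall>\<^sub>F z in at_right x. x < z" using x eventually_at_right[of x \<infinity>] by auto
  then show "\<forall>\<^sub>F z in at_right x. s z < a" if "?L < a" for a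
  proof eventually_elim
    case (elim z)
    then have "s z \<le> ?L" by (auto intro: Sup_upper)
    then show ?case using that by (rule le_less_trans)
  qed
qed

text \<open>These are the only properties of \<open>G \<mu>\<close> that the necessity of (II)
  relies on. Continuity encodes the absence of atoms, and \<open>balanced\<close> encodes the zero
  mean.\<close>

locale balanced_profile =
  fixes g :: "ereal \<Rightarrow> real"
  assumes continuous: "continuous_on UNIV g"
    and mono: "0 \<le> x \<Longrightarrow> x \<le> y \<Longrightarrow> g x \<le> g y"
    and antimono: "x \<le> y \<Longrightarrow> y \<le> 0 \<Longrightarrow> g y \<le> g x"
    and zero: "g 0 = 0"
    and balanced: "g \<infinity> = g (- \<infinity>)"
begin

text \<open>This is \<open>x_minus\<close> at level \<open>g y\<close>. For
  \<open>g = G \<mu>\<close> it is the reciprocating function on the nonnegative half-line.\<close>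

definition partner :: "ereal \<Rightarrow> ereal" where
  "partner y = Sup {x. x \<le> 0 \<and> g y \<le> g x}"

lemma partner_nonpos: "partner y \<le> 0"
  unfolding partner_def by (intro Sup_least) simp

lemma partner_greatest: "x \<le> 0 \<Longrightarrow> g y \<le> g x \<Longrightarrow> x \<le> partner y"
  unfolding partner_def by (intro Sup_upper) simp

text \<open>The set under the supremum is closed, and \<open>balanced\<close> puts -\<infinity> into
  it, so the supremum is attained; this gives one inequality. For the other, the intermediate value
  theorem yields some x \<le> 0 with g x = g y. It lies at or below \<open>partner y\<close>, and g
  is nonincreasing there.\<close>

lemma g_partner:
  assumes "0 \<le> y"
  shows "g (partner y) = g y"
proof (rule antisym)
  have "closed {x. x \<le> 0 \<and> g y \<le> g x}"
    by (intro closed_Collect_conj closed_Collect_le continuous_intros continuous)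
  moreover have "- \<infinity> \<in> {x. x \<le> 0 \<and> g y \<le> g x}"
    using mono[OF assms, of \<infinity>] balanced by simp
  ultimately have "partner y \<in> {x. x \<le> 0 \<and> g y \<le> g x}"
    unfolding partner_def using closed_contains_Sup_cl by blast
  then show "g y \<le> g (partner y)" by simp
  have "\<exists>x\<ge>-\<infinity>. x \<le> 0 \<and> g x = g y"
    using assms mono[of 0 y] mono[of y \<infinity>] zero balanced
    by (intro IVT2') (auto intro: continuous_on_subset[OF continuous])
  then obtain x where "x \<le> 0" "g x = g y" by blast
  then show "g (partner y) \<le> g y"
    using antimono[of x "partner y"] partner_greatest[of x y] partner_nonpos by simp
qed

lemma partner_less:
  assumes "0 \<le> y" "x \<le> 0" "g x < g y"
  shows "partner y < x"
proof (rule ccontr)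
  assume "\<not> partner y < x"
  then have "g (partner y) \<le> g x" using partner_nonpos by (intro antimono) auto
  then show False using assms g_partner by simp
qed

lemma less_partner:
  assumes "0 \<le> y" "x \<le> 0" "g y < g x"
  shows "x < partner y"
proof -
  have "x \<le> partner y" using assms by (intro partner_greatest) auto
  moreover have "x \<noteq> partner y" using assms g_partner by auto
  ultimately show ?thesis by simp
qed

lemma partner_antimono: "g x \<le> g y \<Longrightarrow> partner y \<le> partner x"
  unfolding partner_def by (intro Sup_subset_mono) auto

text \<open>The right-hand side involves g only through values of \<open>partner\<close>, which is
  what uniqueness rests on. For the forward direction, z is a point where g takes the value midway
  between g y and g x; both comparisons with g z are then strict and pass to
  \<open>partner\<close>.\<close>

lemma profile_less_iff:
  assumes "0 \<le> y" "x \<le> 0"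
  shows "g y < g x \<longleftrightarrow> (\<exists>z\<ge>0. x < partner z \<and> partner z < partner y)"
proof
  assume less: "g y < g x"
  define h where "h = (g y + g x) / 2"
  have h: "g y < h" "h < g x" using less by (auto simp: h_def)
  have "\<exists>z\<ge>y. z \<le> \<infinity> \<and> g z = h"
    using h antimono[of "-\<infinity>" x] assms balanced
    by (intro IVT') (auto intro: continuous_on_subset[OF continuous])
  then obtain z where z: "y \<le> z" "g z = h" by blast
  then have "x < partner z" "partner z < partner y"
    using assms h by (auto intro!: less_partner partner_less simp: g_partner partner_nonpos)
  then show "\<exists>z\<ge>0. x < partner z \<and> partner z < partner y" using z(1) assms(1) order_trans by blast
next
  assume "\<exists>z\<ge>0. x < partner z \<and> partner z < partner y"
  then obtain z where z: "0 \<le> z" "x < partner z" "partner z < partner y" by blast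
  have "g y < g z"
    using z(3) partner_antimono[of z y] by fastforce
  also have "g z \<le> g x"
    using antimono[of x "partner z"] z g_partner partner_nonpos by simp
  finally show "g y < g x" .
qed

text \<open>Monotonicity is inherited from g. Left-continuity comes from the maximality of
  \<open>partner x\<close> and the continuity of g. For the last clause, a jump of s at x forces g
  to exceed g x everywhere to the right of x, while g at the right limit L still equals g x. Since g
  (s y) = g y, the value s y cannot be L.\<close>

lemma reciprocating_half_partner:
  assumes s: "\<And>y. 0 \<le> y \<Longrightarrow> s y = partner y"
  shows "reciprocating_half s"
  unfolding reciprocating_half_def
proof (intro conjI ballI allI impI)
  have lim: "(g \<longlongrightarrow> g x) (at x within A)" for x A
    using continuous by (metis continuous_on_def tendsto_within_subset UNIV_I subset_UNIV)
  have anti: "s y \<le> s x" if "0 \<le> x" "x \<le> y" for x y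
    using that s mono partner_antimono by auto
  have s_pos: "s y = partner y" if "0 < y" for y
    using that by (intro s less_imp_le)
  show "s 0 = 0"
    using s[of 0] partner_greatest[of 0 0] partner_nonpos[of 0] by simp
  show "antimono_on {0..} s"
    using anti by (auto simp: monotone_on_def)
  show "(s \<longlongrightarrow> s x) (at_left x)" if "x \<in> {0<..}" for x
  proof (rule order_tendstoI)
    have near: "eventually (\<lambda>y. 0 < y \<and> y < x) (at_left x)"
      using that eventually_at_left[of 0 x] by auto
    show "\<forall>\<^sub>F y in at_left x. a < s y" if "a < s x" for a
      using near
    proof eventually_elim
      case (elim y)
      then show ?case using less_le_trans[OF that anti[of y x]] by (auto simp: less_imp_le)
    qed
    show "\<forall>\<^sub>F y in at_left x. s y < a" if "s x < a" for a
    proof (cases "0 < a")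
      case True
      from near show ?thesis
      proof eventually_elim
        case (elim y)
        then show ?case using s_pos[of y] le_less_trans[OF partner_nonpos True, of y] by simp
      qed
    next
      case False
      \<comment> \<open>As a \<le> 0 lies above the greatest point where g reaches g x, it misses
        that level. By continuity it also misses the level g y for y close to x, so
        \<open>partner y\<close> stays below a.\<close>
      have "g a < g x"
      proof (rule ccontr)
        assume "\<not> g a < g x"
        then have "a \<le> partner x" using False by (intro partner_greatest) auto
        then show False using \<open>s x < a\<close> s_pos[of x] \<open>x \<in> {0<..}\<close> by simp
      qed
      then have "\<forall>\<^sub>F y in at_left x. g a < g y" by (rule order_tendstoD(1)[OF lim])
      with near show ?thesis
      proof eventually_elim
        case (elim y)
        then show ?case using s_pos[of y] partner_less[of y a] False by (simp add: less_imp_le)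
      qed
    qed
  qed
  fix x y :: ereal
  let ?L = "Lim (at_right x) s"
  assume asm: "0 \<le> x \<and> x < y \<and> ?L < s x"
  have near: "eventually (\<lambda>z. x < z \<and> z < y) (at_right x)"
    using asm eventually_at_right[of x y] by auto
  define L where "L = Sup (s ` {x<..})"
  have "antimono_on {x<..} s" "x < \<infinity>"
    using anti asm by (auto simp: monotone_on_def less_imp_le)
  then have tendsto: "(s \<longlongrightarrow> L) (at_right x)" and nontriv: "at_right x \<noteq> bot"
    unfolding L_def by (simp_all add: tendsto_Sup_at_right at_right_ereal_neq_bot)
  then have L: "?L = L" by (intro tendsto_Lim)
  \<comment> \<open>If g did not increase between x and z, then s x \<le> s z \<le> L, contrary to
    the jump at x.\<close>
  have strict: "g x < g z" if "x < z" for z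
  proof (rule ccontr)
    assume "\<not> g x < g z"
    then have "partner x \<le> partner z" using partner_antimono by simp
    then have "s x \<le> L"
      using that asm s[of x] s_pos[of z] by (auto simp: L_def intro!: Sup_upper2[of "s z"])
    then show False using asm L by (auto dest: leD)
  qed
  \<comment> \<open>The limit of g (s z) as z decreases to x is computed twice: by continuity of g
    at L, and from g (s z) = g z by continuity of g at x.\<close>
  have "((\<lambda>z. g (s z)) \<longlongrightarrow> g L) (at_right x)"
    using tendsto continuous by (intro continuous_on_tendsto_compose[of UNIV g]) auto
  moreover have "((\<lambda>z. g (s z)) \<longlongrightarrow> g x) (at_right x)"
    using lim[of x "{x<..}"]
  proof (rule Lim_transform_eventually)
    show "\<forall>\<^sub>F z in at_right x. g z = g (s z)"
      using near by eventually_elim (use asm s_pos g_partner in \<open>auto simp: less_imp_le\<close>)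
  qed
  ultimately have "g L = g x" using nontriv tendsto_unique by blast
  moreover have "g (s y) = g y" using asm s_pos[of y] g_partner[of y] by auto
  ultimately have "s y \<noteq> L" using strict[of y] asm by auto
  moreover have "s y \<le> L" using asm by (auto simp: L_def intro: Sup_upper)
  ultimately show "s y < ?L" using L by simp
qed

end

section \<open>The profile of a non-atomic zero-mean measure\<close>

lemma nonatomic_singleton_null:
  assumes "nonatomic M" "{x} \<in> sets M"
  shows "emeasure M {x} = 0"
proof (rule ccontr)
  assume "emeasure M {x} \<noteq> 0"
  moreover have "emeasure M B = 0" if "B \<subseteq> {x}" "emeasure M B < emeasure M {x}" for B
    using that by (cases "B = {}") (auto dest: subset_singletonD)
  ultimately have "measure_atom M {x}"
    using assms(2) by (auto simp: measure_atom_def zero_less_iff_neq_zero)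
  then show False using assms(1) by (auto simp: nonatomic_def)
qed

text \<open>For each x at least one of the two intervals is empty. A single integrand for both signs
  of x allows continuity, also at 0, to be proved without splitting cases.\<close>

lemma G_eq:
  "G \<mu> x = (\<integral>z. indicator {z. 0 < ereal z \<and> ereal z \<le> x \<or> x \<le> ereal z \<and> ereal z < 0} z * \<bar>z\<bar> \<partial>\<mu>)"
proof (cases "0 \<le> x")
  case True
  then have "\<not> (x \<le> ereal z \<and> ereal z < 0)" for z by (metis leD order_trans)
  then show ?thesis
    unfolding G_def set_lebesgue_integral_def if_P[OF True]
    by (auto intro!: Bochner_Integration.integral_cong simp: indicator_def)
next
  case False
  then have "\<not> (0 < ereal z \<and> ereal z \<le> x)" for z by (metis less_le order_trans)
  then show ?thesis
    unfolding G_def set_lebesgue_integral_def if_not_P[OF False]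
    by (intro Bochner_Integration.integral_cong) (auto simp: indicator_def)
qed

lemma balanced_profile_G:
  assumes zm: "zero_mean_prob \<mu>" and na: "nonatomic \<mu>"
  shows "balanced_profile (G \<mu>)"
proof
  interpret prob_space \<mu> using zm by (simp add: zero_mean_prob_def)
  have sets[measurable_cong]: "sets \<mu> = sets borel" using zm by (simp add: zero_mean_prob_def)
  have abs: "integrable \<mu> (\<lambda>x. \<bar>x\<bar>)" and mean: "(\<integral>x. x \<partial>\<mu>) = 0"
    using zm by (auto simp: zero_mean_prob_def)
  have id: "integrable \<mu> (\<lambda>x. x)"
    using abs by (rule integrable_abs_cancel) (simp add: measurable_ident_sets sets)
  define A where "A x = {z. 0 < ereal z \<and> ereal z \<le> x \<or> x \<le> ereal z \<and> ereal z < 0}" for x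
  have A[measurable]: "A x \<in> sets borel" for x unfolding A_def by measurable
  have int: "integrable \<mu> (\<lambda>z. indicator (A x) z * \<bar>z\<bar>)" for x
    using integrable_mult_indicator[OF _ abs, of "A x"] sets by simp
  have G: "G \<mu> x = (\<integral>z. indicator (A x) z * \<bar>z\<bar> \<partial>\<mu>)" for x
    unfolding G_eq A_def ..
  have G_mono: "G \<mu> x \<le> G \<mu> y" if "A x \<subseteq> A y" for x y
    unfolding G using that by (intro integral_mono int) (auto simp: indicator_def)
  show "G \<mu> x \<le> G \<mu> y" if "0 \<le> x" "x \<le> y" for x y
    by (intro G_mono) (use that in \<open>cases x; cases y; auto simp: A_def\<close>)
  show "G \<mu> y \<le> G \<mu> x" if "x \<le> y" "y \<le> 0" for x y
    by (intro G_mono) (use that in \<open>cases x; cases y; auto simp: A_def\<close>)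
  have "A 0 = {}" unfolding A_def by (auto simp: zero_ereal_def)
  then show "G \<mu> 0 = 0" unfolding G by simp
  show "G \<mu> \<infinity> = G \<mu> (- \<infinity>)"
  proof -
    have "G \<mu> \<infinity> - G \<mu> (- \<infinity>) = (\<integral>z. indicator (A \<infinity>) z * \<bar>z\<bar> - indicator (A (-\<infinity>)) z * \<bar>z\<bar> \<partial>\<mu>)"
      unfolding G by (rule Bochner_Integration.integral_diff[symmetric]) (rule int)+
    also have "\<dots> = (\<integral>z. z \<partial>\<mu>)"
      by (intro Bochner_Integration.integral_cong) (auto simp: A_def indicator_def)
    finally show ?thesis using mean by simp
  qed
  show "continuous_on UNIV (G \<mu>)"
    unfolding continuous_on_eq_continuous_at[OF open_UNIV]
  proof (intro ballI continuous_at_sequentiallyI)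
    fix x :: ereal and u assume u: "u \<longlonglongrightarrow> x"
    show "(\<lambda>n. G \<mu> (u n)) \<longlonglongrightarrow> G \<mu> x"
      unfolding G
    proof (rule integral_dominated_convergence[where w="\<lambda>z. \<bar>z\<bar>"])
      \<comment> \<open>Off the point x, membership of z in \<open>A (u n)\<close> depends only on
        the side of \<open>u n\<close> on which z lies, and this is eventually the side of x. For
        infinite x, \<open>real_of_ereal x\<close> is 0; excluding that point is harmless because it
        is null.\<close>
      have "AE z in \<mu>. z \<noteq> real_of_ereal x"
        using nonatomic_singleton_null[OF na, of "real_of_ereal x"] sets
        by (intro AE_I[of _ _ "{real_of_ereal x}"]) auto
      then show "AE z in \<mu>. (\<lambda>n. indicator (A (u n)) z * \<bar>z\<bar>) \<longlonglongrightarrow> indicator (A x) z * \<bar>z\<bar>"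
      proof eventually_elim
        case (elim z)
        then have "ereal z < x \<or> x < ereal z" by (cases x) auto
        then have "\<forall>\<^sub>F n in sequentially. (z \<in> A (u n) \<longleftrightarrow> z \<in> A x)"
        proof
          assume "ereal z < x"
          from order_tendstoD(1)[OF u this] show ?thesis
            by eventually_elim (use \<open>ereal z < x\<close> in \<open>auto simp: A_def\<close>)
        next
          assume "x < ereal z"
          from order_tendstoD(2)[OF u this] show ?thesis
            by eventually_elim (use \<open>x < ereal z\<close> in \<open>auto simp: A_def\<close>)
        qed
        then show ?case
          by (intro tendsto_eventually) (auto elim: eventually_mono simp: indicator_def)
      qed
      show "AE z in \<mu>. norm (indicator (A (u n)) z * \<bar>z\<bar>) \<le> \<bar>z\<bar>" for n
        by (simp add: indicator_def)
    qed (rule borel_measurable_integrable[OF int] abs)+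
  qed
qed

lemma reciprocating_fun_nonneg:
  assumes "zero_mean_prob \<mu>" "nonatomic \<mu>" "0 \<le> y"
  shows "reciprocating_fun \<mu> y = balanced_profile.partner (G \<mu>) y"
  unfolding balanced_profile.partner_def[OF balanced_profile_G[OF assms(1,2)]]
  using assms(3) by (simp add: reciprocating_fun_def x_minus_def)

text \<open>The infimum in \<open>x_plus\<close> is rewritten by \<open>profile_less_iff\<close> so
  that only values at nonnegative arguments occur. Two reciprocating functions that agree there must
  then agree everywhere.\<close>

lemma reciprocating_fun_neg:
  assumes "zero_mean_prob \<mu>" "nonatomic \<mu>" "x < 0"
  shows "reciprocating_fun \<mu> x =
    Inf {y. 0 \<le> y \<and> \<not> (\<exists>z\<ge>0. x < reciprocating_fun \<mu> z \<and> reciprocating_fun \<mu> z < reciprocating_fun \<mu> y)}"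
proof -
  interpret balanced_profile "G \<mu>" using assms(1,2) by (rule balanced_profile_G)
  have "{y. 0 \<le> y \<and> G \<mu> x \<le> G \<mu> y} =
    {y. 0 \<le> y \<and> \<not> (\<exists>z\<ge>0. x < reciprocating_fun \<mu> z \<and> reciprocating_fun \<mu> z < reciprocating_fun \<mu> y)}"
    using assms profile_less_iff[of _ x] by (force simp: reciprocating_fun_nonneg not_less[symmetric])
  moreover have "reciprocating_fun \<mu> x = Inf {y. 0 \<le> y \<and> G \<mu> x \<le> G \<mu> y}"
    using assms(3) leD[of 0 x] by (auto simp: reciprocating_fun_def x_plus_def)
  ultimately show ?thesis by simp
qed

lemma reciprocating_extension_half:
  assumes "reciprocating_extension s r"
  shows "reciprocating_half s"
proof -
  obtain \<mu> where \<mu>: "zero_mean_prob \<mu>" "nonatomic \<mu>" "r = reciprocating_fun \<mu>"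
    using assms by (auto simp: reciprocating_extension_def)
  have "s y = balanced_profile.partner (G \<mu>) y" if "0 \<le> y" for y
    using assms that \<mu> reciprocating_fun_nonneg by (auto simp: reciprocating_extension_def)
  then show ?thesis
    using balanced_profile.reciprocating_half_partner[OF balanced_profile_G] \<mu> by blast
qed

lemma reciprocating_extension_unique:
  assumes "reciprocating_extension s r" "reciprocating_extension s r'"
  shows "r = r'"
proof
  fix x
  have neg: "t x = Inf {y. 0 \<le> y \<and> \<not> (\<exists>z\<ge>0. x < s z \<and> s z < s y)}"
    if ext: "reciprocating_extension s t" and "x < 0" for t
  proof -
    obtain \<mu> where \<mu>: "zero_mean_prob \<mu>" "nonatomic \<mu>" "t = reciprocating_fun \<mu>"
      and eq: "\<And>y. 0 \<le> y \<Longrightarrow> t y = s y"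
      using ext by (auto simp: reciprocating_extension_def)
    have "{y. 0 \<le> y \<and> \<not> (\<exists>z\<ge>0. x < t z \<and> t z < t y)} = {y. 0 \<le> y \<and> \<not> (\<exists>z\<ge>0. x < s z \<and> s z < s y)}"
      using eq by auto
    then show ?thesis using reciprocating_fun_neg[OF \<mu>(1,2) \<open>x < 0\<close>] \<mu>(3) by simp
  qed
  show "r x = r' x"
  proof (cases "0 \<le> x")
    case True
    then show ?thesis using assms by (auto simp: reciprocating_extension_def)
  next
    case False
    then show ?thesis using neg[OF assms(1)] neg[OF assms(2)] by simp
  qed
qed

section \<open>Continuous representation of a gap-free order\<close>

text \<open>Nonnegativity of a matches the definition of \<open>dyadics\<close> by quotients with
  natural numerators. The upper of two neighbouring fractions straddling a, closer together than b -
  a, lies below b.\<close>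

lemma dyadic_between:
  fixes a b :: real
  assumes "0 \<le> a" "a < b"
  obtains d where "d \<in> dyadics" "a < d" "d < b"
proof -
  have "0 < b - a" "1 < (2::real)" using assms by auto
  from padic_rational_approximation_straddle_pos_le[OF this assms(1)]
  obtain n q r where "of_nat q / 2 ^ n \<le> a" "a < of_nat r / 2 ^ n"
    "\<bar>real q / 2 ^ n - real r / 2 ^ n\<bar> < b - a" .
  then show ?thesis by (intro that[of "real r / 2 ^ n"]) (auto simp: dyadics_def abs_if split: if_splits)
qed

text \<open>As in Urysohn's lemma, with the nested open sets replaced by a family of points \<open>q d\<close>, for
  \<open>d\<close> dyadic in \<open>[0, 1]\<close>, from \<open>q 0 = a\<close> to \<open>q 1 = b\<close>, along which \<open>\<sigma>\<close> strictly decreases.\<close>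
lemma separating_function:
  fixes \<sigma> :: "real \<Rightarrow> 'a::linorder"
  assumes anti: "antimono \<sigma>"
    and dense: "\<And>x y. \<sigma> y < \<sigma> x \<Longrightarrow> \<exists>z. \<sigma> y < \<sigma> z \<and> \<sigma> z < \<sigma> x"
    and less: "\<sigma> b < \<sigma> a"
  obtains f :: "real \<Rightarrow> real" where
    "continuous_on UNIV f" "mono f" "\<And>x y. \<sigma> x = \<sigma> y \<Longrightarrow> f x = f y"
    "f a = 0" "f b = 1" "\<And>x. 0 \<le> f x" "\<And>x. f x \<le> 1"
proof -
  let ?D = "dyadics \<inter> {0..1} :: real set"
  have "\<exists>q :: real \<Rightarrow> real. q 0 = a \<and> q 1 = b \<and>
    (\<forall>x\<in>?D. \<forall>y\<in>?D. x < y \<longrightarrow> \<sigma> (q y) < \<sigma> (q x))"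
  proof (rule recursion_on_dyadic_fractions)
    show "\<exists>z. \<sigma> z < \<sigma> x \<and> \<sigma> y < \<sigma> z" if "\<sigma> y < \<sigma> x" for x y
      using dense[OF that] by blast
  qed (use less in auto)
  then obtain q :: "real \<Rightarrow> real" where q: "q 0 = a" "q 1 = b"
    and q_less: "\<And>x y. x \<in> ?D \<Longrightarrow> y \<in> ?D \<Longrightarrow> x < y \<Longrightarrow> \<sigma> (q y) < \<sigma> (q x)"
    by blast
  have D01: "0 \<in> ?D" "1 \<in> ?D" using real_in_dyadics[of 0] real_in_dyadics[of 1] by auto
  have le_iff: "x \<le> y \<longleftrightarrow> \<sigma> (q y) \<le> \<sigma> (q x)" if "x \<in> ?D" "y \<in> ?D" for x y
    using q_less[OF that] q_less[OF that(2,1)] by (cases x y rule: linorder_cases) auto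
  \<comment> \<open>Points are compared with \<open>q d\<close> through \<sigma>, so that f is
    constant on the level sets of \<sigma>. Inserting 0 keeps the set nonempty where \<sigma>
    exceeds \<sigma> a.\<close>
  define S where "S x = insert 0 {d \<in> ?D. \<sigma> x \<le> \<sigma> (q d)}" for x
  define f where "f x = Sup (S x)" for x
  have S: "S x \<subseteq> {0..1}" "0 \<in> S x" for x by (auto simp: S_def)
  have bdd: "bdd_above (S x)" for x using S(1) by (meson bdd_above_Icc bdd_above_mono)
  have f_ge: "d \<le> f x" if "d \<in> S x" for d x
    unfolding f_def using that bdd by (rule cSup_upper)
  have f_q: "f (q d) = d" if "d \<in> ?D" for d
    unfolding f_def
  proof (rule cSup_eq_maximum)
    show "d \<in> S (q d)" using that by (auto simp: S_def)
    show "e \<le> d" if "e \<in> S (q d)" for e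
      using that \<open>d \<in> ?D\<close> le_iff by (auto simp: S_def)
  qed
  have bounds: "0 \<le> f x" "f x \<le> 1" for x
  proof -
    show "0 \<le> f x" using S(2) by (rule f_ge)
    show "f x \<le> 1" unfolding f_def using S by (intro cSup_least) (blast, force)
  qed
  have mono_f: "f x \<le> f y" if "x \<le> y" for x y
    unfolding f_def using S(2)[of x] bdd
  proof (intro cSup_subset_mono)
    show "S x \<subseteq> S y" using antimonoD[OF anti that] by (auto simp: S_def)
  qed auto
  \<comment> \<open>A monotone function whose range is dense in [0, 1] cannot jump. Here f takes
    every dyadic value d of [0, 1], at \<open>q d\<close>. Bounds c outside [0, 1] are split off
    because no suitable d need exist for them.\<close>
  have cont: "isCont f x" for x
    unfolding isCont_def
  proof (rule order_tendstoI)
    fix c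
    show "\<forall>\<^sub>F y in at x. c < f y" if c: "c < f x"
    proof (cases "c < 0")
      case True
      then show ?thesis using bounds(1) by (intro always_eventually) (meson order.strict_trans2)
    next
      case False
      obtain d where d: "d \<in> dyadics" "c < d" "d < f x"
        by (rule dyadic_between[of c "f x"]) (use False c in auto)
      then have D: "d \<in> ?D" using False bounds(2)[of x] by auto
      have "q d < x" using mono_f[of x "q d"] f_q[OF D] d by force
      then have "\<forall>\<^sub>F y in at x. q d < y" by (intro order_tendstoD[OF tendsto_ident_at])
      then show ?thesis
      proof eventually_elim
        case (elim y)
        then show ?case using mono_f[of "q d" y] f_q[OF D] d by simp
      qed
    qed
    show "\<forall>\<^sub>F y in at x. f y < c" if c: "f x < c"
    proof (cases "1 < c")
      case True
      then show ?thesis using bounds(2) by (intro always_eventually) (meson order.strict_trans1)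
    next
      case False
      obtain d where d: "d \<in> dyadics" "f x < d" "d < c"
        by (rule dyadic_between[of "f x" c]) (use bounds c in auto)
      then have D: "d \<in> ?D" using False bounds(1)[of x] by auto
      have "x < q d" using mono_f[of "q d" x] f_q[OF D] d by force
      then have "\<forall>\<^sub>F y in at x. y < q d" by (intro order_tendstoD[OF tendsto_ident_at])
      then show ?thesis
      proof eventually_elim
        case (elim y)
        then show ?case using mono_f[of y "q d"] f_q[OF D] d by simp
      qed
    qed
  qed
  show ?thesis
  proof (rule that[of f])
    show "f x = f y" if "\<sigma> x = \<sigma> y" for x y using that by (simp add: f_def S_def)
    show "f a = 0" "f b = 1" using f_q[OF D01(1)] f_q[OF D01(2)] q by auto
  qed (use cont bounds mono_f in \<open>auto simp: continuous_on_eq_continuous_at intro: monoI\<close>)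
qed

lemma continuous_order_representation:
  fixes \<sigma> :: "real \<Rightarrow> 'a::linorder"
  assumes anti: "antimono \<sigma>"
    and dense: "\<And>x y. \<sigma> y < \<sigma> x \<Longrightarrow> \<exists>z. \<sigma> y < \<sigma> z \<and> \<sigma> z < \<sigma> x"
  obtains F :: "real \<Rightarrow> real" where
    "continuous_on UNIV F" "mono F" "bounded (range F)" "\<And>x y. F x < F y \<longleftrightarrow> \<sigma> y < \<sigma> x"
proof -
  \<comment> \<open>A monotone function separating one pair of points suffices: sum such functions, with weights
    \<open>2\<^sup>-\<^sup>n\<close>, over the pairs of rationals.\<close>
  define P where "P f \<longleftrightarrow> continuous_on UNIV f \<and> mono f \<and> (\<forall>x y. \<sigma> x = \<sigma> y \<longrightarrow> f x = f y) \<and>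
    (\<forall>x. 0 \<le> f x \<and> f x \<le> 1)" for f :: "real \<Rightarrow> real"
  define p :: "nat \<Rightarrow> rat \<times> rat" where "p = from_nat"
  define A where "A n = real_of_rat (fst (p n))" for n
  define B where "B n = real_of_rat (snd (p n))" for n
  have "\<exists>f. P f \<and> (\<sigma> (B n) < \<sigma> (A n) \<longrightarrow> f (A n) < f (B n))" for n
  proof (cases "\<sigma> (B n) < \<sigma> (A n)")
    case True
    show ?thesis
    proof (rule separating_function[OF anti dense True])
      fix h :: "real \<Rightarrow> real"
      assume h: "continuous_on UNIV h" "mono h" "\<And>x y. \<sigma> x = \<sigma> y \<Longrightarrow> h x = h y"
        "h (A n) = 0" "h (B n) = 1" "\<And>x. 0 \<le> h x" "\<And>x. h x \<le> 1"
      have "P h" unfolding P_def using h(1,2,3,6,7) by blast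
      then show ?thesis using h(4,5) by (intro exI[of _ h]) simp
    qed
  next
    case False
    then show ?thesis by (intro exI[of _ "\<lambda>_. 0"]) (auto simp: P_def monoI)
  qed
  then have "\<exists>f. \<forall>n. P (f n) \<and> (\<sigma> (B n) < \<sigma> (A n) \<longrightarrow> f n (A n) < f n (B n))"
    by (intro choice allI)
  then obtain f where f: "\<And>n. P (f n)"
    and f_less: "\<And>n. \<sigma> (B n) < \<sigma> (A n) \<Longrightarrow> f n (A n) < f n (B n)" by blast
  let ?t = "\<lambda>n x. (1/2) ^ n * f n x"
  define F where "F x = (\<Sum>n. ?t n x)" for x
  have f01: "0 \<le> f n x" "f n x \<le> 1" for n x
    using f[of n] unfolding P_def by blast+
  have f_cont: "continuous_on UNIV (f n)" for n using f[of n] unfolding P_def by blast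
  have geo: "summable (\<lambda>n. (1/2::real) ^ n)" by (simp add: summable_geometric)
  have bound: "norm (?t n x) \<le> (1/2) ^ n" for n x
    using f01[of n x] by (simp add: mult_left_le)
  have summable: "summable (\<lambda>n. ?t n x)" for x
    by (rule summable_comparison_test[OF _ geo]) (use bound in blast)
  have f_mono: "f n x \<le> f n y" if "x \<le> y" for n x y
    using f[of n] that unfolding P_def mono_def by blast
  have F_mono: "F x \<le> F y" if "x \<le> y" for x y
    unfolding F_def by (intro suminf_le summable mult_left_mono f_mono that) simp
  have uniform: "uniform_limit UNIV (\<lambda>n x. \<Sum>i<n. ?t i x) F sequentially"
    unfolding F_def by (rule Weierstrass_m_test[OF bound geo])
  have "continuous_on UNIV F"
  proof (rule uniform_limit_theorem[OF _ uniform])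
    show "\<forall>\<^sub>F n in sequentially. continuous_on UNIV (\<lambda>x. \<Sum>i<n. ?t i x)"
      by (intro always_eventually allI continuous_intros f_cont)
  qed simp
  moreover have "mono F" using F_mono by (rule monoI)
  moreover have "bounded (range F)"
  proof (rule boundedI)
    fix y assume "y \<in> range F"
    then obtain x where y: "y = F x" by auto
    have "0 \<le> F x" unfolding F_def by (intro suminf_nonneg summable mult_nonneg_nonneg f01) simp
    moreover have "F x \<le> (\<Sum>n. (1/2) ^ n)"
      unfolding F_def using f01 by (intro suminf_le summable geo mult_left_le) auto
    ultimately show "norm y \<le> (\<Sum>n. (1/2) ^ n)" using y by simp
  qed
  moreover have "F x < F y \<longleftrightarrow> \<sigma> y < \<sigma> x" for x y
  proof
    assume less: "F x < F y"
    have "\<sigma> x \<noteq> \<sigma> y"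
    proof
      assume "\<sigma> x = \<sigma> y"
      then have "f n x = f n y" for n using f[of n] unfolding P_def by blast
      then have "F x = F y" by (simp add: F_def)
      then show False using less by simp
    qed
    moreover have "x \<le> y" using less F_mono[of y x] by force
    ultimately show "\<sigma> y < \<sigma> x" using antimonoD[OF anti, of x y] by simp
  next
    assume less: "\<sigma> y < \<sigma> x"
    \<comment> \<open>Density of the values only gives real points. Two successive intermediate
      values trap a rational argument r between w' and w, and monotonicity keeps its value strictly
      inside.\<close>
    have rat: "\<exists>r. \<sigma> v < \<sigma> (real_of_rat r) \<and> \<sigma> (real_of_rat r) < \<sigma> u" if "\<sigma> v < \<sigma> u" for u v
    proof -
      obtain w where w: "\<sigma> v < \<sigma> w" "\<sigma> w < \<sigma> u" using dense \<open>\<sigma> v < \<sigma> u\<close> by blast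
      obtain w' where w': "\<sigma> w < \<sigma> w'" "\<sigma> w' < \<sigma> u" using dense w by blast
      have "w' < w" using w'(1) antimonoD[OF anti, of w w'] by force
      then obtain r where "w' < real_of_rat r" "real_of_rat r < w" using of_rat_dense by blast
      then have "\<sigma> w \<le> \<sigma> (real_of_rat r)" "\<sigma> (real_of_rat r) \<le> \<sigma> w'"
        using antimonoD[OF anti] by (simp_all add: less_imp_le)
      then show ?thesis using w w' by (meson order.strict_trans1 order.strict_trans2)
    qed
    \<comment> \<open>A rational pair nested between x and y in the order of \<sigma> is needed: the
      summand belonging to this pair grows strictly from x to y, and no other summand
      decreases.\<close>
    obtain r1 where r1: "\<sigma> y < \<sigma> (real_of_rat r1)" "\<sigma> (real_of_rat r1) < \<sigma> x" using rat less by blast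
    obtain r2 where r2: "\<sigma> y < \<sigma> (real_of_rat r2)" "\<sigma> (real_of_rat r2) < \<sigma> (real_of_rat r1)"
      using rat r1 by blast
    have ord: "x \<le> real_of_rat r1" "real_of_rat r2 \<le> y" "x \<le> y"
      using r1 r2 less antimonoD[OF anti] by (meson linorder_not_less nle_le)+
    obtain n where n: "p n = (r1, r2)" unfolding p_def by (metis from_nat_to_nat)
    then have AB: "A n = real_of_rat r1" "B n = real_of_rat r2" by (auto simp: A_def B_def)
    have "f n x \<le> f n (A n)" "f n (A n) < f n (B n)" "f n (B n) \<le> f n y"
      using ord r2 f_less[of n] AB by (auto intro: f_mono)
    then have "?t n x < ?t n y" by simp
    moreover have "?t i x \<le> ?t i y" for i using ord(3) f_mono by (simp add: mult_left_mono)
    ultimately have "0 < (\<Sum>i. ?t i y - ?t i x)"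
      using summable by (intro suminf_pos2[of _ n] summable_diff) auto
    then show "F x < F y" unfolding F_def using suminf_diff[OF summable summable, of y x] by simp
  qed
  ultimately show ?thesis by (rule that)
qed

section \<open>Measure-theoretic tools\<close>

text \<open>Without point masses the distribution function of M restricted to A is continuous, so it
  takes half of the mass of A as a value at some t. Then the part of A up to t has positive but
  smaller mass, and A is not an atom.\<close>

lemma nonatomicI_no_point_mass:
  fixes M :: "real measure"
  assumes "finite_measure M" and sets: "sets M = sets borel"
    and null: "\<And>x. emeasure M {x} = 0"
  shows "nonatomic M"
  unfolding nonatomic_def
proof
  assume "\<exists>A. measure_atom M A"
  then obtain A where A: "A \<in> sets M" "emeasure M A > 0"
    and atom: "\<And>B. B \<in> sets M \<Longrightarrow> B \<subseteq> A \<Longrightarrow> emeasure M B < emeasure M A \<Longrightarrow> emeasure M B = 0"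
    by (auto simp: measure_atom_def)
  interpret finite_measure M by fact
  define N where "N = density M (indicator A)"
  have N: "emeasure N B = emeasure M (A \<inter> B)" if "B \<in> sets borel" for B
    using that A(1) sets by (simp add: N_def emeasure_density nn_integral_indicator' flip: indicator_inter_arith)
  have space: "space N = UNIV" using sets sets_eq_imp_space_eq[OF sets] by (simp add: N_def)
  interpret N: finite_borel_measure N
  proof (intro finite_borel_measure.intro finite_borel_measure_axioms.intro finite_measureI)
    show "sets N = sets borel" by (simp add: N_def sets)
    have "emeasure N (space N) = emeasure M A" using N[of UNIV] space by simp
    then show "emeasure N (space N) \<noteq> \<infinity>" by simp
  qed
  define c where "c = measure N (space N)"
  have c: "emeasure M A = ennreal c"
    using N[of UNIV] space by (simp add: c_def N.emeasure_eq_measure[symmetric])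
  have "0 < c" using A(2) c by simp
  have "measure N {x} = 0" for x
    using N[of "{x}"] null[of x] emeasure_mono[of "A \<inter> {x}" "{x}" M] sets by (simp add: measure_def)
  then have cont: "isCont (cdf N) x" for x by (simp add: N.isCont_cdf)
  have "\<forall>\<^sub>F x in at_bot. cdf N x < c / 2"
    using \<open>0 < c\<close> by (intro order_tendstoD[OF N.cdf_lim_at_bot]) simp
  then obtain a where a: "cdf N a < c / 2" by (auto simp: eventually_at_bot_linorder)
  have "\<forall>\<^sub>F x in at_top. c / 2 < cdf N x"
    using \<open>0 < c\<close> by (intro order_tendstoD[OF N.cdf_lim_at_top]) (simp add: c_def)
  then obtain b where b: "c / 2 < cdf N b" by (auto simp: eventually_at_top_linorder)
  have "a \<le> b" using N.cdf_nondecreasing[of b a] a b by linarith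
  then obtain t where t: "cdf N t = c / 2"
    using IVT[of "cdf N" a "c / 2" b] a b cont by auto
  have "emeasure N {..t} = ennreal (c / 2)"
    unfolding N.emeasure_eq_measure t[symmetric] cdf_def ..
  then have half: "emeasure M (A \<inter> {..t}) = ennreal (c / 2)" using N[of "{..t}"] by simp
  have "emeasure M (A \<inter> {..t}) = 0"
    using half c \<open>0 < c\<close> A(1) sets by (intro atom) (auto simp: ennreal_less_iff)
  then show False using half \<open>0 < c\<close> by simp
qed

text \<open>The sum of the two weighted images is obtained as one image measure. Two copies of N,
  indexed by \<open>bool\<close>, carry the densities u and v and are mapped by f and g. Tonelli's
  theorem splits the integral into the two terms.\<close>

lemma pushforward_sum:
  fixes u v :: "'a \<Rightarrow> ennreal" and f g :: "'a \<Rightarrow> 'b"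
  assumes "sigma_finite_measure N"
    and [measurable]: "u \<in> borel_measurable N" "v \<in> borel_measurable N"
    and [measurable]: "f \<in> measurable N M" "g \<in> measurable N M"
  obtains \<mu> where "sets \<mu> = sets M"
    "\<And>h. h \<in> borel_measurable M \<Longrightarrow>
      (\<integral>\<^sup>+z. h z \<partial>\<mu>) = (\<integral>\<^sup>+y. u y * h (f y) \<partial>N) + (\<integral>\<^sup>+y. v y * h (g y) \<partial>N)"
proof -
  interpret sigma_finite_measure N by fact
  define Q where "Q = count_space (UNIV :: bool set) \<Otimes>\<^sub>M N"
  define U where "U p = (if fst p then u (snd p) else v (snd p))" for p
  define T where "T p = (if fst p then f (snd p) else g (snd p))" for p
  have U[measurable]: "U \<in> borel_measurable Q"
    unfolding Q_def U_def
  proof (rule measurable_pair_measure_countable1)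
    show "(\<lambda>y. if fst (b, y) then u (snd (b, y)) else v (snd (b, y))) \<in> borel_measurable N" for b
      by (cases b) simp_all
  qed simp
  have T[measurable]: "T \<in> measurable Q M"
    unfolding Q_def T_def
  proof (rule measurable_pair_measure_countable1)
    show "(\<lambda>y. if fst (b, y) then f (snd (b, y)) else g (snd (b, y))) \<in> measurable N M" for b
      by (cases b) simp_all
  qed simp
  define \<mu> where "\<mu> = distr (density Q U) M T"
  have "(\<integral>\<^sup>+z. h z \<partial>\<mu>) = (\<integral>\<^sup>+y. u y * h (f y) \<partial>N) + (\<integral>\<^sup>+y. v y * h (g y) \<partial>N)"
    if [measurable]: "h \<in> borel_measurable M" for h
  proof -
    have "(\<integral>\<^sup>+z. h z \<partial>\<mu>) = (\<integral>\<^sup>+p. U p * h (T p) \<partial>Q)"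
      unfolding \<mu>_def by (simp add: nn_integral_distr nn_integral_density)
    also have "\<dots> = (\<integral>\<^sup>+b. \<integral>\<^sup>+y. U (b, y) * h (T (b, y)) \<partial>N \<partial>count_space UNIV)"
      unfolding Q_def by (rule nn_integral_fst[symmetric]) (fold Q_def, measurable)
    also have "\<dots> = (\<integral>\<^sup>+y. u y * h (f y) \<partial>N) + (\<integral>\<^sup>+y. v y * h (g y) \<partial>N)"
      by (simp add: nn_integral_count_space_finite UNIV_bool U_def T_def add.commute)
    finally show ?thesis .
  qed
  moreover have "sets \<mu> = sets M" by (simp add: \<mu>_def)
  ultimately show ?thesis by (intro that)
qed

text \<open>A bounded piece of the fibre is compact, so it lies between its least point a and its
  greatest point b. The interval from a to b has mass F b - F a = v - v = 0.\<close>

lemma interval_measure_fibre_null: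
  assumes cont: "continuous_on UNIV F" and "mono F"
  shows "emeasure (interval_measure F) {y. F y = v} = 0"
proof -
  have mono: "F x \<le> F y" if "x \<le> y" for x y using \<open>mono F\<close> that by (rule monoD)
  define K where "K n = {y \<in> {- real n..real n}. F y = v}" for n
  have "closed {y. F y = v}" using cont by (intro closed_Collect_eq) auto
  moreover have K_Int: "K n = {- real n..real n} \<inter> {y. F y = v}" for n by (auto simp: K_def)
  ultimately have K: "compact (K n)" for n by (metis compact_Icc compact_Int_closed)
  have "emeasure (interval_measure F) (K n) = 0" for n
  proof (cases "K n = {}")
    case False
    obtain a where a: "a \<in> K n" "\<And>y. y \<in> K n \<Longrightarrow> a \<le> y" using compact_attains_inf[OF K False] by auto
    obtain b where b: "b \<in> K n" "\<And>y. y \<in> K n \<Longrightarrow> y \<le> b" using compact_attains_sup[OF K False] by auto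
    have "emeasure (interval_measure F) (K n) \<le> emeasure (interval_measure F) {a..b}"
      using a b by (intro emeasure_mono) auto
    also have "\<dots> = ennreal (F b - F a)"
      using a b by (intro emeasure_interval_measure_Icc mono cont) auto
    also have "\<dots> = 0" using a b by (simp add: K_def)
    finally show ?thesis by simp
  qed simp
  moreover have "K n \<in> sets (interval_measure F)" for n
    using K[of n] by (simp add: borel_compact)
  ultimately have "emeasure (interval_measure F) (\<Union>n. K n) = 0"
    by (intro emeasure_UN_eq_0) auto
  moreover have "(\<Union>n. K n) = {y. F y = v}"
  proof -
    have "\<exists>n. y \<in> {- real n..real n}" for y
    proof -
      obtain n where "\<bar>y\<bar> \<le> real n" using real_arch_simple by blast
      then show ?thesis by (intro exI[of _ n]) auto
    qed
    then show ?thesis by (auto simp: K_def)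
  qed
  ultimately show ?thesis by simp
qed

lemma finite_interval_measure:
  assumes cont: "continuous_on UNIV F" and "mono F" and "bounded (range F)"
  shows "finite_measure (interval_measure F)"
proof (rule finite_measureI)
  have mono: "F x \<le> F y" if "x \<le> y" for x y using \<open>mono F\<close> that by (rule monoD)
  have cont_right: "continuous (at_right a) F" for a
    using cont by (simp add: continuous_on_eq_continuous_at continuous_at_imp_continuous_at_within)
  obtain B where B: "\<And>x. \<bar>F x\<bar> \<le> B" using \<open>bounded (range F)\<close> by (auto simp: bounded_iff)
  have UN: "(\<Union>n. {- real n<..real n}) = UNIV"
  proof -
    have "\<exists>n. y \<in> {- real n<..real n}" for y
    proof -
      obtain n where "\<bar>y\<bar> < real n" using reals_Archimedean2 by blast
      then show ?thesis by (intro exI[of _ n]) auto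
    qed
    then show ?thesis by auto
  qed
  have "emeasure (interval_measure F) UNIV = (SUP n. emeasure (interval_measure F) {- real n<..real n})"
    unfolding UN[symmetric] by (rule SUP_emeasure_incseq[symmetric]) (auto simp: incseq_def)
  also have "\<dots> \<le> ennreal (2 * B)"
  proof (rule SUP_least)
    fix n
    have "emeasure (interval_measure F) {- real n<..real n} = ennreal (F (real n) - F (- real n))"
      by (intro emeasure_interval_measure_Ioc mono cont_right) simp
    also have "\<dots> \<le> ennreal (2 * B)"
      using B[of "real n"] B[of "- real n"] by (intro ennreal_leI) linarith
    finally show "emeasure (interval_measure F) {- real n<..real n} \<le> ennreal (2 * B)" .
  qed
  finally show "emeasure (interval_measure F) (space (interval_measure F)) \<noteq> \<infinity>"
    by (auto simp: top_unique)
qed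

section \<open>Existence of a measure\<close>

lemma reciprocating_half_nonpos:
  assumes "reciprocating_half s" "0 \<le> y"
  shows "s y \<le> 0"
  using assms monotone_onD[of "{0..}" "(\<le>)" "(\<ge>)" s 0 y] by (simp add: reciprocating_half_def)

lemma reciprocating_half_antimono:
  assumes "reciprocating_half s" "0 \<le> x" "x \<le> y"
  shows "s y \<le> s x"
proof -
  have "antimono_on {0..} s" using assms by (simp add: reciprocating_half_def)
  then show ?thesis using assms order_trans[of 0 x y] by (auto dest: monotone_onD)
qed

text \<open>The bound z is the supremum of the superlevel set. Left-continuity puts z itself into
  that set: otherwise s would be below c immediately to the left of z, where the set must have
  points.\<close>

lemma reciprocating_half_level:
  assumes half: "reciprocating_half s" and c: "c \<le> 0"
  obtains z where "0 \<le> z" "\<And>y. 0 \<le> y \<Longrightarrow> c \<le> s y \<longleftrightarrow> y \<le> z"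
proof -
  define A where "A = {y. 0 \<le> y \<and> c \<le> s y}"
  define z where "z = Sup A"
  have "s 0 = 0" using half by (simp add: reciprocating_half_def)
  then have "0 \<in> A" using c by (simp add: A_def)
  then have "0 \<le> z" unfolding z_def by (rule Sup_upper)
  have "c \<le> s z"
  proof (rule ccontr)
    assume "\<not> c \<le> s z"
    then have less: "s z < c" by simp
    then have "0 < z" using \<open>0 \<le> z\<close> \<open>s 0 = 0\<close> c by (cases "z = 0") auto
    then have "(s \<longlongrightarrow> s z) (at_left z)" using half by (simp add: reciprocating_half_def)
    then have "\<forall>\<^sub>F y in at_left z. s y < c" using less by (rule order_tendstoD)
    then obtain b where b: "b < z" "\<And>y. b < y \<Longrightarrow> y < z \<Longrightarrow> s y < c"
      unfolding eventually_at_left[OF \<open>0 < z\<close>] by blast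
    obtain a where a: "a \<in> A" "b < a" using b(1) unfolding z_def less_Sup_iff by blast
    have "a \<le> z" unfolding z_def using a(1) by (rule Sup_upper)
    moreover have "c \<le> s a" using a(1) by (simp add: A_def)
    ultimately show False using b(2)[OF a(2)] less by (auto simp: order_le_less dest: leD)
  qed
  show ?thesis
  proof (rule that[OF \<open>0 \<le> z\<close>])
    fix y :: ereal assume "0 \<le> y"
    show "c \<le> s y \<longleftrightarrow> y \<le> z"
    proof
      show "y \<le> z" if "c \<le> s y"
        unfolding z_def using that \<open>0 \<le> y\<close> by (intro Sup_upper) (simp add: A_def)
      show "c \<le> s y" if "y \<le> z"
        using \<open>c \<le> s z\<close> reciprocating_half_antimono[OF half \<open>0 \<le> y\<close> that] by (rule order_trans)
    qed
  qed
qed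

text \<open>This is the order-theoretic content of the last clause of (II). Suppose no value lies
  strictly between, and let z be the last point with s z \<ge> s x. To the right of z all values are
  at most s y, hence so is the right limit at z. Thus s jumps at z, and the clause puts s y strictly
  below that limit, a contradiction.\<close>

lemma reciprocating_half_dense:
  assumes half: "reciprocating_half s" and "0 \<le> x" "0 \<le> y" and less: "s y < s x"
  shows "\<exists>z\<ge>0. s y < s z \<and> s z < s x"
proof (rule ccontr)
  assume contra: "\<not> (\<exists>z\<ge>0. s y < s z \<and> s z < s x)"
  obtain z where z: "0 \<le> z" "\<And>y. 0 \<le> y \<Longrightarrow> s x \<le> s y \<longleftrightarrow> y \<le> z"
    using reciprocating_half_level[OF half reciprocating_half_nonpos[OF half \<open>0 \<le> x\<close>]] by blast
  have "s x \<le> s z" using z by blast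
  have "z < y" using z(2)[OF \<open>0 \<le> y\<close>] less by (metis not_le)
  then have "z < \<infinity>" by auto
  let ?L = "Sup (s ` {z<..})"
  have anti: "antimono_on {z<..} s"
    using reciprocating_half_antimono[OF half] z(1) by (auto simp: monotone_on_def intro: order_trans less_imp_le)
  have Lim: "Lim (at_right z) s = ?L"
    by (intro tendsto_Lim at_right_ereal_neq_bot tendsto_Sup_at_right anti \<open>z < \<infinity>\<close>)
  have "?L \<le> s y"
  proof (rule SUP_least)
    fix w assume "w \<in> {z<..}"
    then have "0 \<le> w" "\<not> s x \<le> s w" using z by (auto intro: order_trans less_imp_le dest: leD)
    then show "s w \<le> s y" using contra not_le by blast
  qed
  moreover have "?L < s z" using \<open>?L \<le> s y\<close> less \<open>s x \<le> s z\<close> by (metis le_less_trans less_le_trans)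
  then have "s y < ?L"
    using half z(1) \<open>z < y\<close> Lim unfolding reciprocating_half_def by metis
  ultimately show False by (simp add: leD)
qed

text \<open>The measure \<nu> is the Stieltjes measure of the function F that represents the order
  of \<sigma>. F is constant on each level set of \<sigma>, which makes level sets null, and it
  increases wherever \<sigma> drops. Truncating the argument at 0 turns s into a function on the
  whole real line.\<close>

lemma reciprocating_half_measure:
  assumes half: "reciprocating_half s"
  defines "\<sigma> \<equiv> \<lambda>y. s (ereal (max 0 y))"
  obtains \<nu> :: "real measure" where
    "finite_measure \<nu>" "sets \<nu> = sets borel" "\<And>c. emeasure \<nu> {y. \<sigma> y = c} = 0"
    "\<And>a b. a \<le> b \<Longrightarrow> \<sigma> b < \<sigma> a \<Longrightarrow> 0 < emeasure \<nu> {a<..b}"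
proof -
  have anti: "antimono \<sigma>"
    unfolding \<sigma>_def by (intro antimonoI reciprocating_half_antimono[OF half]) (auto simp: max_def)
  have nonneg: "0 \<le> ereal (max 0 x)" for x by (simp add: max_def)
  have dense: "\<exists>z. \<sigma> y < \<sigma> z \<and> \<sigma> z < \<sigma> x" if "\<sigma> y < \<sigma> x" for x y
  proof -
    obtain z where z: "0 \<le> z" "\<sigma> y < s z" "s z < \<sigma> x"
      using reciprocating_half_dense[OF half nonneg nonneg \<open>\<sigma> y < \<sigma> x\<close>[unfolded \<sigma>_def]]
      unfolding \<sigma>_def by blast
    \<comment> \<open>The intermediate value might be attained only at \<infinity>, which \<sigma>
      does not see. Being below a real number, z is finite.\<close>
    have "z < ereal (max 0 y)"
    proof (rule ccontr)
      assume "\<not> z < ereal (max 0 y)"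
      then have "ereal (max 0 y) \<le> z" by (simp only: not_less)
      then have "s z \<le> \<sigma> y" unfolding \<sigma>_def by (rule reciprocating_half_antimono[OF half nonneg])
      then show False using z(2) by (simp add: leD)
    qed
    with z(1) obtain r where "z = ereal r" "0 \<le> r" by (cases z) auto
    then have "s z = \<sigma> r" by (simp add: \<sigma>_def max_def)
    then show ?thesis using z by auto
  qed
  obtain F :: "real \<Rightarrow> real" where cont: "continuous_on UNIV F" and "mono F" "bounded (range F)"
    and F: "\<And>x y. F x < F y \<longleftrightarrow> \<sigma> y < \<sigma> x"
    using continuous_order_representation[OF anti dense] by blast
  define \<nu> where "\<nu> = interval_measure F"
  have fibre: "emeasure \<nu> {y. \<sigma> y = c} = 0" for c
  proof (cases "\<exists>y0. \<sigma> y0 = c")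
    case True
    then obtain y0 where y0: "\<sigma> y0 = c" by blast
    have "{y. \<sigma> y = c} \<subseteq> {y. F y = F y0}"
      using F y0 by (metis (mono_tags, lifting) Collect_mono linorder_neq_iff)
    moreover have "{y. F y = F y0} \<in> sets \<nu>"
      using cont unfolding \<nu>_def by (simp add: borel_closed closed_Collect_eq)
    ultimately have "emeasure \<nu> {y. \<sigma> y = c} \<le> emeasure \<nu> {y. F y = F y0}"
      by (rule emeasure_mono)
    then show ?thesis
      using interval_measure_fibre_null[OF cont \<open>mono F\<close>] by (simp add: \<nu>_def)
  qed simp
  have pos: "0 < emeasure \<nu> {a<..b}" if "a \<le> b" "\<sigma> b < \<sigma> a" for a b
  proof -
    have "emeasure \<nu> {a<..b} = ennreal (F b - F a)"
      unfolding \<nu>_def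
    proof (rule emeasure_interval_measure_Ioc[OF that(1)])
      show "F x \<le> F y" if "x \<le> y" for x y using \<open>mono F\<close> that by (rule monoD)
      show "continuous (at_right a) F" for a
        using cont by (simp add: continuous_on_eq_continuous_at continuous_at_imp_continuous_at_within)
    qed
    then show ?thesis using F that by simp
  qed
  show ?thesis
  proof (rule that)
    show "finite_measure \<nu>" unfolding \<nu>_def by (rule finite_interval_measure) fact+
    show "sets \<nu> = sets borel" by (simp add: \<nu>_def)
  qed (fact fibre pos)+
qed

text \<open>The measure \<kappa> is w \<nu> divided by the normalising constant c. It represents |z|
  \<mu>(dz) on both half-lines: directly on the positive one, and through \<sigma> on the negative
  one. The equal total masses give zero mean, and both branches of G become \<kappa>-measures of
  sets of parameters y.\<close>

lemma zero_mean_prob_pushforward: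
  fixes \<nu> :: "real measure" and \<sigma> :: "real \<Rightarrow> ereal"
  assumes fin: "finite_measure \<nu>" and sets_\<nu>: "sets \<nu> = sets borel"
    and \<sigma>: "\<sigma> \<in> borel_measurable borel" and nonpos: "\<And>y. \<sigma> y \<le> 0"
    and fibre: "\<And>c. emeasure \<nu> {y. \<sigma> y = c} = 0"
    and nontrivial: "emeasure \<nu> {0<..} \<noteq> 0"
  obtains \<mu> \<kappa> :: "real measure" where
    "zero_mean_prob \<mu>" "nonatomic \<mu>" "finite_measure \<kappa>" "sets \<kappa> = sets borel"
    "\<And>x. 0 \<le> x \<Longrightarrow> G \<mu> x = measure \<kappa> {y. 0 < y \<and> ereal y \<le> x}"
    "\<And>x. x \<le> 0 \<Longrightarrow> G \<mu> x = measure \<kappa> {y. 0 < y \<and> x \<le> \<sigma> y}"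
    "\<And>A. A \<in> sets borel \<Longrightarrow> A \<subseteq> {0<..} \<Longrightarrow> emeasure \<nu> A \<noteq> 0 \<Longrightarrow> 0 < measure \<kappa> A"
proof -
  interpret finite_measure \<nu> by fact
  note [measurable_cong] = sets_\<nu>
  note [measurable] = \<sigma>
  have space_\<nu>: "space \<nu> = UNIV" using sets_eq_imp_space_eq[OF sets_\<nu>] by simp
  have AE_\<sigma>: "AE y in \<nu>. \<sigma> y \<noteq> c" for c
  proof (rule AE_I)
    show "{y \<in> space \<nu>. \<not> \<sigma> y \<noteq> c} \<subseteq> {y. \<sigma> y = c}" by auto
    show "{y. \<sigma> y = c} \<in> sets \<nu>" unfolding sets_\<nu> by measurable
  qed (fact fibre)
  \<comment> \<open>\<open>real_of_ereal\<close> sends -\<infinity> to 0, so t y < 0 holds exactly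
    where \<sigma> y is finite and negative. This is \<nu>-almost everywhere, since the levels 0 and
    -\<infinity> are null.\<close>
  define t where "t y = real_of_ereal (\<sigma> y)" for y
  have t[measurable]: "t \<in> borel_measurable borel" unfolding t_def by measurable
  have t_nonpos: "t y \<le> 0" for y
    using nonpos[of y] unfolding t_def by (cases "\<sigma> y") auto
  have t_neg: "\<sigma> y = ereal (t y)" if "t y < 0" for y
    using that unfolding t_def by (cases "\<sigma> y") auto
  have AE_t: "AE y in \<nu>. t y < 0"
    using AE_\<sigma>[of 0] AE_\<sigma>[of "-\<infinity>"]
  proof eventually_elim
    case (elim y)
    then show ?case using nonpos[of y] unfolding t_def by (cases "\<sigma> y") auto
  qed
  \<comment> \<open>The minimum with y and - t y keeps the densities u and v at most 1, and the
    minimum with 1 keeps \<kappa> finite. On the positive half-line w vanishes only where t is 0, a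
    null set.\<close>
  define w where "w y = (if 0 < y \<and> t y < 0 then min 1 (min y (- t y)) else 0)" for y
  define u where "u y = w y / y" for y
  define v where "v y = w y / (- t y)" for y
  have [measurable]: "w \<in> borel_measurable borel" unfolding w_def by measurable
  have [measurable]: "u \<in> borel_measurable borel" "v \<in> borel_measurable borel"
    unfolding u_def v_def by measurable
  have w01: "0 \<le> w y" "w y \<le> 1" for y by (auto simp: w_def)
  have u01: "0 \<le> u y" "u y \<le> 1" for y by (auto simp: u_def w_def divide_le_eq)
  have v01: "0 \<le> v y" "v y \<le> 1" for y
  proof -
    show "0 \<le> v y" using w01 t_nonpos[of y] unfolding v_def by (intro divide_nonneg_nonneg) auto
    show "v y \<le> 1"
    proof (cases "t y < 0")
      case True
      then have "w y \<le> - t y" by (auto simp: w_def min_def)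
      then show ?thesis using True unfolding v_def by (subst divide_le_eq_1_pos) auto
    qed (simp add: v_def w_def)
  qed
  have integrable: "integrable \<nu> f" if "f \<in> borel_measurable \<nu>" "\<And>y. 0 \<le> f y" "\<And>y. f y \<le> 1" for f :: "real \<Rightarrow> real"
    using that by (intro integrable_const_bound[of _ 1]) auto
  have int: "integrable \<nu> u" "integrable \<nu> v"
    using u01 v01 by (auto intro!: integrable)
  define c where "c = (\<integral>y. u y \<partial>\<nu>) + (\<integral>y. v y \<partial>\<nu>)"
  have null: "emeasure \<nu> A = 0" if A: "A \<in> sets borel" "A \<subseteq> {0<..}" and "AE y in \<nu>. y \<in> A \<longrightarrow> w y = 0" for A
  proof -
    from AE_t that(3) have "AE y in \<nu>. y \<notin> A"
    proof eventually_elim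
      case (elim y)
      then show ?case using A(2) by (auto simp: w_def min_def split: if_splits)
    qed
    then show ?thesis using A(1) by (subst (asm) AE_iff_measurable[OF _ refl]) (auto simp: sets_\<nu> space_\<nu>)
  qed
  have "0 < c"
  proof (rule ccontr)
    assume "\<not> 0 < c"
    moreover have "0 \<le> (\<integral>y. u y \<partial>\<nu>)" "0 \<le> (\<integral>y. v y \<partial>\<nu>)"
      using u01 v01 by (auto intro: integral_nonneg_AE)
    ultimately have "(\<integral>y. u y \<partial>\<nu>) = 0" by (simp add: c_def)
    then have "AE y in \<nu>. u y = 0"
      using integral_nonneg_eq_0_iff_AE[OF int(1)] u01 by simp
    then have "AE y in \<nu>. y \<in> {0<..} \<longrightarrow> w y = 0"
      by eventually_elim (auto simp: u_def)
    then show False using null[of "{0<..}"] nontrivial by simp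
  qed
  define \<kappa> where "\<kappa> = density \<nu> (\<lambda>y. ennreal (w y / c))"
  have sets_\<kappa>: "sets \<kappa> = sets borel" by (simp add: \<kappa>_def sets_\<nu>)
  have \<kappa>: "emeasure \<kappa> A = (\<integral>\<^sup>+y. ennreal (w y / c) * indicator A y \<partial>\<nu>)" if "A \<in> sets borel" for A
    unfolding \<kappa>_def using that by (intro emeasure_density) (auto simp: sets_\<nu>)
  interpret \<kappa>: finite_measure \<kappa>
  proof (rule finite_measureI)
    have "emeasure \<kappa> (space \<kappa>) = (\<integral>\<^sup>+y. ennreal (w y / c) \<partial>\<nu>)"
      using sets_eq_imp_space_eq[OF sets_\<kappa>] by (simp add: \<kappa>)
    also have "\<dots> \<le> (\<integral>\<^sup>+y. ennreal (1 / c) \<partial>\<nu>)"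
      using w01 \<open>0 < c\<close> by (intro nn_integral_mono ennreal_leI divide_right_mono) auto
    also have "\<dots> < top"
      by (simp add: emeasure_eq_measure ennreal_mult_less_top)
    finally show "emeasure \<kappa> (space \<kappa>) \<noteq> \<infinity>" by simp
  qed
  have sf: "sigma_finite_measure \<nu>" by unfold_locales
  have m: "(\<lambda>y. ennreal (u y / c)) \<in> borel_measurable \<nu>" "(\<lambda>y. ennreal (v y / c)) \<in> borel_measurable \<nu>"
    "(\<lambda>y. y) \<in> measurable \<nu> borel" "t \<in> measurable \<nu> borel"
    by measurable
  obtain \<mu> :: "real measure" where sets_\<mu>: "sets \<mu> = sets borel"
    and nn: "\<And>h. h \<in> borel_measurable borel \<Longrightarrow> (\<integral>\<^sup>+z. h z \<partial>\<mu>) =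
      (\<integral>\<^sup>+y. ennreal (u y / c) * h y \<partial>\<nu>) + (\<integral>\<^sup>+y. ennreal (v y / c) * h (t y) \<partial>\<nu>)"
    by (rule pushforward_sum[OF sf m]) (rule that)
  note [measurable_cong] = sets_\<mu>
  have space_\<mu>: "space \<mu> = UNIV" using sets_eq_imp_space_eq[OF sets_\<mu>] by simp
  interpret \<mu>: prob_space \<mu>
  proof
    have "emeasure \<mu> (space \<mu>) = (\<integral>\<^sup>+z. 1 \<partial>\<mu>)" by simp
    also have "\<dots> = (\<integral>\<^sup>+y. ennreal (u y / c) \<partial>\<nu>) + (\<integral>\<^sup>+y. ennreal (v y / c) \<partial>\<nu>)"
      by (subst nn) auto
    also have "\<dots> = ennreal ((\<integral>y. u y / c \<partial>\<nu>) + (\<integral>y. v y / c \<partial>\<nu>))"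
      using u01 v01 \<open>0 < c\<close> int
      by (subst (1 2) nn_integral_eq_integral) (auto intro!: integral_nonneg_AE)
    also have "(\<integral>y. u y / c \<partial>\<nu>) + (\<integral>y. v y / c \<partial>\<nu>) = 1"
      using \<open>0 < c\<close> by (simp add: c_def add_divide_distrib[symmetric])
    finally show "emeasure \<mu> (space \<mu>) = 1" by simp
  qed
  \<comment> \<open>The factor z cancels the denominator of u and leaves w. The second summand
    vanishes because t is nonpositive. In \<open>neg\<close> the roles of the summands are
    exchanged.\<close>
  have pos: "(\<integral>\<^sup>+z. ennreal (indicator B z * z) \<partial>\<mu>) = emeasure \<kappa> B"
    if B[measurable]: "B \<in> sets borel" and "B \<subseteq> {0<..}" for B
  proof -
    have u_eq: "ennreal (u y / c) * ennreal (indicator B y * y) = ennreal (w y / c) * indicator B y" for y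
    proof (cases "y \<in> B")
      case True
      then have "0 < y" using \<open>B \<subseteq> {0<..}\<close> by auto
      then show ?thesis using True u01(1)[of y] \<open>0 < c\<close>
        by (simp add: ennreal_mult[symmetric]) (simp add: u_def)
    qed simp
    have v_eq: "ennreal (v y / c) * ennreal (indicator B (t y) * t y) = 0" for y
      using \<open>B \<subseteq> {0<..}\<close> t_nonpos[of y] by (auto simp: indicator_def)
    have "(\<integral>\<^sup>+z. ennreal (indicator B z * z) \<partial>\<mu>) =
      (\<integral>\<^sup>+y. ennreal (u y / c) * ennreal (indicator B y * y) \<partial>\<nu>) +
      (\<integral>\<^sup>+y. ennreal (v y / c) * ennreal (indicator B (t y) * t y) \<partial>\<nu>)"
      by (rule nn) measurable
    then show ?thesis unfolding u_eq v_eq by (simp add: \<kappa>)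
  qed
  have neg: "(\<integral>\<^sup>+z. ennreal (indicator B z * (- z)) \<partial>\<mu>) = emeasure \<kappa> {y. t y \<in> B}"
    if B[measurable]: "B \<in> sets borel" and "B \<subseteq> {..<0}" for B
  proof -
    have u_eq: "ennreal (u y / c) * ennreal (indicator B y * (- y)) = 0" for y
    proof (cases "y \<in> B")
      case True
      then have "y < 0" using \<open>B \<subseteq> {..<0}\<close> by auto
      then show ?thesis by (simp add: u_def w_def)
    qed simp
    have v_eq: "ennreal (v y / c) * ennreal (indicator B (t y) * (- t y)) = ennreal (w y / c) * indicator {y. t y \<in> B} y" for y
    proof (cases "t y \<in> B")
      case True
      then have "t y < 0" using \<open>B \<subseteq> {..<0}\<close> by auto
      then show ?thesis using True v01(1)[of y] \<open>0 < c\<close>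
        by (simp add: ennreal_mult[symmetric]) (simp add: v_def)
    qed simp
    have "{y. t y \<in> B} \<in> sets borel" using measurable_sets[OF t B] by (simp add: vimage_def)
    moreover have "(\<integral>\<^sup>+z. ennreal (indicator B z * (- z)) \<partial>\<mu>) =
      (\<integral>\<^sup>+y. ennreal (u y / c) * ennreal (indicator B y * (- y)) \<partial>\<nu>) +
      (\<integral>\<^sup>+y. ennreal (v y / c) * ennreal (indicator B (t y) * (- t y)) \<partial>\<nu>)"
      by (rule nn) measurable
    ultimately show ?thesis unfolding u_eq v_eq by (simp add: \<kappa>)
  qed
  have int_pos: "integrable \<mu> (\<lambda>z. indicator B z * z)" "(\<integral>z. indicator B z * z \<partial>\<mu>) = measure \<kappa> B"
    if B[measurable]: "B \<in> sets borel" and "B \<subseteq> {0<..}" for B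
  proof -
    have nonneg: "0 \<le> indicator B z * z" for z :: real using \<open>B \<subseteq> {0<..}\<close> by (auto simp: indicator_def)
    then show "integrable \<mu> (\<lambda>z. indicator B z * z)"
      using pos[OF that] by (intro integrableI_nonneg) (auto simp: \<kappa>.emeasure_finite less_top[symmetric])
    show "(\<integral>z. indicator B z * z \<partial>\<mu>) = measure \<kappa> B"
      using nonneg pos[OF that] by (subst integral_eq_nn_integral) (auto simp: measure_def)
  qed
  have int_neg: "integrable \<mu> (\<lambda>z. indicator B z * (- z))" "(\<integral>z. indicator B z * (- z) \<partial>\<mu>) = measure \<kappa> {y. t y \<in> B}"
    if B[measurable]: "B \<in> sets borel" and "B \<subseteq> {..<0}" for B
  proof -
    have nonneg: "0 \<le> indicator B z * (- z)" for z :: real using \<open>B \<subseteq> {..<0}\<close> by (auto simp: indicator_def)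
    then show "integrable \<mu> (\<lambda>z. indicator B z * (- z))"
      using neg[OF that] by (intro integrableI_nonneg) (auto simp: \<kappa>.emeasure_finite less_top[symmetric])
    show "(\<integral>z. indicator B z * (- z) \<partial>\<mu>) = measure \<kappa> {y. t y \<in> B}"
      using nonneg neg[OF that] by (subst integral_eq_nn_integral) (auto simp: measure_def)
  qed
  have AE_\<kappa>: "AE y in \<kappa>. 0 < y \<and> t y < 0 \<and> \<sigma> y = ereal (t y)"
    unfolding \<kappa>_def
  proof (subst AE_density)
    show "AE y in \<nu>. 0 < ennreal (w y / c) \<longrightarrow> 0 < y \<and> t y < 0 \<and> \<sigma> y = ereal (t y)"
      using t_neg by (auto simp: w_def)
  qed simp
  have measure_\<kappa>: "measure \<kappa> A = measure \<kappa> B"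
    if "A \<in> sets borel" "B \<in> sets borel" "\<And>y. 0 < y \<Longrightarrow> t y < 0 \<Longrightarrow> \<sigma> y = ereal (t y) \<Longrightarrow> y \<in> A \<longleftrightarrow> y \<in> B" for A B
  proof (rule \<kappa>.finite_measure_eq_AE)
    show "AE y in \<kappa>. y \<in> A \<longleftrightarrow> y \<in> B" using AE_\<kappa> by eventually_elim (use that(3) in blast)
  qed (use that sets_\<kappa> in auto)
  have "zero_mean_prob \<mu>"
    unfolding zero_mean_prob_def
  proof (intro conjI)
    let ?p = "\<lambda>z::real. indicator {0<..} z * z" and ?n = "\<lambda>z::real. indicator {..<0} z * (- z)"
    have p: "integrable \<mu> ?p" and n: "integrable \<mu> ?n" by (intro int_pos int_neg; simp)+
    have "integrable \<mu> (\<lambda>z. ?p z + ?n z)" using p n by (rule Bochner_Integration.integrable_add)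
    also have "(\<lambda>z. ?p z + ?n z) = (\<lambda>z. \<bar>z\<bar>)" by (auto simp: fun_eq_iff indicator_def)
    finally show "integrable \<mu> (\<lambda>z. \<bar>z\<bar>)" .
    have "(\<integral>z. z \<partial>\<mu>) = (\<integral>z. ?p z - ?n z \<partial>\<mu>)"
      by (intro Bochner_Integration.integral_cong) (auto simp: indicator_def)
    also have "\<dots> = (\<integral>z. ?p z \<partial>\<mu>) - (\<integral>z. ?n z \<partial>\<mu>)" using p n by (rule Bochner_Integration.integral_diff)
    also have "\<dots> = measure \<kappa> {0<..} - measure \<kappa> {y. t y \<in> {..<0}}"
      by (subst int_pos int_neg, simp, simp)+ simp
    also have "measure \<kappa> {0<..} = measure \<kappa> {y. t y \<in> {..<0}}"
      by (rule measure_\<kappa>) auto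
    finally show "(\<integral>z. z \<partial>\<mu>) = 0" by simp
  qed (fact sets_\<mu> \<mu>.prob_space_axioms)+
  moreover have "nonatomic \<mu>"
  proof (rule nonatomicI_no_point_mass)
    fix x
    \<comment> \<open>The point x lies in its own level set of \<sigma>, which is null. Likewise,
      the preimage of x under t lies almost everywhere in the level set of \<sigma> at x.\<close>
    have "AE y in \<nu>. ennreal (u y / c) * indicator {x} y = 0"
      using AE_\<sigma>[of "\<sigma> x"] by eventually_elim (auto simp: indicator_def)
    then have 1: "(\<integral>\<^sup>+y. ennreal (u y / c) * indicator {x} y \<partial>\<nu>) = 0"
      by (subst nn_integral_0_iff_AE) auto
    have "AE y in \<nu>. ennreal (v y / c) * indicator {x} (t y) = 0"
      using AE_\<sigma>[of "ereal x"] AE_t by eventually_elim (use t_neg in \<open>auto simp: indicator_def\<close>)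
    then have 2: "(\<integral>\<^sup>+y. ennreal (v y / c) * indicator {x} (t y) \<partial>\<nu>) = 0"
      by (subst nn_integral_0_iff_AE) auto
    have "emeasure \<mu> {x} = (\<integral>\<^sup>+z. indicator {x} z \<partial>\<mu>)" using sets_\<mu> by simp
    also have "\<dots> = 0" by (subst nn) (simp_all add: 1 2 del: nn_integral_indicator)
    finally show "emeasure \<mu> {x} = 0" .
  qed (use sets_\<mu> \<mu>.finite_measure_axioms in auto)
  moreover have G_nonneg: "G \<mu> x = measure \<kappa> {y. 0 < y \<and> ereal y \<le> x}" if "0 \<le> x" for x
  proof -
    have "G \<mu> x = (\<integral>z. indicator {y. 0 < y \<and> ereal y \<le> x} z * z \<partial>\<mu>)"
      using that by (simp add: G_def set_lebesgue_integral_def)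
    also have "\<dots> = measure \<kappa> {y. 0 < y \<and> ereal y \<le> x}" by (intro int_pos) auto
    finally show ?thesis .
  qed
  moreover have "G \<mu> x = measure \<kappa> {y. 0 < y \<and> x \<le> \<sigma> y}" if "x \<le> 0" for x
  \<comment> \<open>At 0 the definition of G takes its nonnegative branch. Both sides are 0 there,
    because \<sigma> is negative \<kappa>-almost everywhere.\<close>
  proof (cases "x = 0")
    case True
    have empty: "{y. 0 < y \<and> ereal y \<le> 0} = {}" by auto
    have "measure \<kappa> {} = measure \<kappa> {y. 0 < y \<and> 0 \<le> \<sigma> y}"
      by (rule measure_\<kappa>) (auto simp: zero_ereal_def)
    then show ?thesis unfolding True G_nonneg[OF order_refl] empty .
  next
    case False
    then have "x < 0" using that by simp
    let ?B = "{z. x \<le> ereal z \<and> z < 0}"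
    have "G \<mu> x = (\<integral>z. indicator ?B z * (- z) \<partial>\<mu>)"
      using \<open>x < 0\<close> unfolding G_def set_lebesgue_integral_def by (subst if_not_P) (auto simp: not_le)
    also have "\<dots> = measure \<kappa> {y. t y \<in> ?B}" by (intro int_neg) auto
    also have "\<dots> = measure \<kappa> {y. 0 < y \<and> x \<le> \<sigma> y}" by (rule measure_\<kappa>) auto
    finally show ?thesis .
  qed
  moreover have "0 < measure \<kappa> A" if "A \<in> sets borel" "A \<subseteq> {0<..}" "emeasure \<nu> A \<noteq> 0" for A
  proof -
    have "emeasure \<kappa> A \<noteq> 0"
    proof
      assume "emeasure \<kappa> A = 0"
      then have "AE y in \<nu>. ennreal (w y / c) * indicator A y = 0"
        using that(1) by (simp add: \<kappa> nn_integral_0_iff_AE sets_\<nu>)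
      then have "AE y in \<nu>. y \<in> A \<longrightarrow> w y = 0"
      proof eventually_elim
        case (elim y)
        then show ?case using w01(1)[of y] \<open>0 < c\<close> by (auto simp: ennreal_eq_0_iff divide_le_0_iff)
      qed
      then show False using null[OF that(1,2)] that(3) by simp
    qed
    then show ?thesis by (simp add: \<kappa>.emeasure_eq_measure zero_less_measure_iff)
  qed
  ultimately show ?thesis using that[of \<mu> \<kappa>] \<kappa>.finite_measure_axioms sets_\<kappa> by blast
qed

text \<open>It remains to see that s y is the greatest x \<le> 0 with G x \<ge> G y. It satisfies
  the inequality because parameters up to y have \<sigma>-values at least s y. If a larger x =
  \<open>partner y\<close> did too, its superlevel set would end at some z < y, so G x = G z. As s
  drops between z and y, \<kappa> charges that interval, and G z < G y contradicts G x = G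
  y.\<close>

lemma reciprocating_extension_exists:
  assumes half: "reciprocating_half s" and "\<exists>x\<in>{0..}. s x \<noteq> 0"
  shows "\<exists>r. reciprocating_extension s r"
proof -
  define \<sigma> where "\<sigma> y = s (ereal (max 0 y))" for y
  have "s 0 = 0" using half by (simp add: reciprocating_half_def)
  have nonneg: "0 \<le> ereal (max 0 y)" for y by (simp add: max_def)
  have \<sigma>_pos: "\<sigma> y = s (ereal y)" if "0 \<le> y" for y using that by (simp add: \<sigma>_def max_def)
  have nonpos: "\<sigma> y \<le> 0" for y unfolding \<sigma>_def by (rule reciprocating_half_nonpos[OF half nonneg])
  have level: "\<exists>z\<ge>0. \<forall>y\<ge>0. c \<le> s y \<longleftrightarrow> y \<le> z" if "c \<le> 0" for c
    using reciprocating_half_level[OF half that] by metis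
  have \<sigma>_measurable: "\<sigma> \<in> borel_measurable borel"
  proof (rule borel_measurableI_ge)
    fix c :: ereal
    show "{y \<in> space borel. c \<le> \<sigma> y} \<in> sets borel"
    proof (cases "c \<le> 0")
      case True
      then obtain z where "\<forall>y\<ge>0. c \<le> s y \<longleftrightarrow> y \<le> z" using level by blast
      then have "{y \<in> space borel. c \<le> \<sigma> y} = {y. ereal (max 0 y) \<le> z}"
        using nonneg unfolding \<sigma>_def by auto
      then show ?thesis by simp
    next
      case False
      then have "{y \<in> space borel. c \<le> \<sigma> y} = {}" using nonpos order_trans by blast
      then show ?thesis by simp
    qed
  qed
  obtain \<nu> where \<nu>: "finite_measure \<nu>" "sets \<nu> = sets borel" "\<And>c. emeasure \<nu> {y. \<sigma> y = c} = 0"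
    and \<nu>_pos: "\<And>a b. a \<le> b \<Longrightarrow> \<sigma> b < \<sigma> a \<Longrightarrow> 0 < emeasure \<nu> {a<..b}"
    using reciprocating_half_measure[OF half] unfolding \<sigma>_def by metis
  \<comment> \<open>The right end b may be \<infinity>, where \<nu> has no direct estimate. An
    intermediate value of s, attained at a finite z below b, gives a subinterval with real endpoints
    that already has positive mass.\<close>
  have interval_pos: "emeasure \<nu> {z. a < ereal z \<and> ereal z \<le> b} \<noteq> 0"
    if "0 \<le> a" "a < b" "s b < s a" for a b
  proof -
    have "0 \<le> b" using that by auto
    then obtain z where z: "0 \<le> z" "s b < s z" "s z < s a"
      using reciprocating_half_dense[OF half \<open>0 \<le> a\<close> _ \<open>s b < s a\<close>] by blast
    have "a < z" "z < b"
      using z that reciprocating_half_antimono[OF half] \<open>0 \<le> b\<close> by (metis leD not_le)+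
    then obtain a' z' where [simp]: "a = ereal a'" "z = ereal z'" using \<open>0 \<le> a\<close> by (cases a; cases z) auto
    have "0 < emeasure \<nu> {a'<..z'}"
      using z that \<open>a < z\<close> by (intro \<nu>_pos) (auto simp: \<sigma>_pos)
    also have "\<dots> \<le> emeasure \<nu> {z. a < ereal z \<and> ereal z \<le> b}"
    proof (rule emeasure_mono)
      have "ereal y \<le> b" if "y \<le> z'" for y
        using that \<open>z < b\<close> order_trans[of "ereal y" "ereal z'" b] by (auto simp: less_imp_le)
      then show "{a'<..z'} \<subseteq> {z. a < ereal z \<and> ereal z \<le> b}" by auto
      show "{z. a < ereal z \<and> ereal z \<le> b} \<in> sets \<nu>" unfolding \<nu>(2) by measurable
    qed
    finally show ?thesis by simp
  qed
  \<comment> \<open>A nonzero value of s ensures that \<nu> has mass on the positive half-line, so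
    that the construction can be normalised.\<close>
  obtain x0 where "0 \<le> x0" "s x0 \<noteq> 0" using assms(2) by auto
  then have "s x0 < s 0" "0 < x0"
    using reciprocating_half_nonpos[OF half \<open>0 \<le> x0\<close>] \<open>s 0 = 0\<close> by (auto simp: less_le)
  then have "emeasure \<nu> {z. 0 < ereal z \<and> ereal z \<le> x0} \<noteq> 0" by (intro interval_pos) auto
  moreover have "emeasure \<nu> {z. 0 < ereal z \<and> ereal z \<le> x0} \<le> emeasure \<nu> {0<..}"
    by (rule emeasure_mono) (auto simp: \<nu>(2))
  ultimately have nontrivial: "emeasure \<nu> {0<..} \<noteq> 0" by auto
  obtain \<mu> \<kappa> where zm: "zero_mean_prob \<mu>" and na: "nonatomic \<mu>"
    and \<kappa>: "finite_measure \<kappa>" "sets \<kappa> = sets borel"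
    and G_pos: "\<And>x. 0 \<le> x \<Longrightarrow> G \<mu> x = measure \<kappa> {y. 0 < y \<and> ereal y \<le> x}"
    and G_neg: "\<And>x. x \<le> 0 \<Longrightarrow> G \<mu> x = measure \<kappa> {y. 0 < y \<and> x \<le> \<sigma> y}"
    and \<kappa>_pos: "\<And>A. A \<in> sets borel \<Longrightarrow> A \<subseteq> {0<..} \<Longrightarrow> emeasure \<nu> A \<noteq> 0 \<Longrightarrow> 0 < measure \<kappa> A"
    by (rule zero_mean_prob_pushforward[OF \<nu>(1,2) \<sigma>_measurable nonpos \<nu>(3) nontrivial]) (rule that)
  interpret finite_measure \<kappa> by fact
  interpret balanced_profile "G \<mu>" using zm na by (rule balanced_profile_G)
  have "reciprocating_fun \<mu> y = s y" if "0 \<le> y" for y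
  proof -
    have "G \<mu> y \<le> G \<mu> (s y)"
    proof -
      have "measure \<kappa> {z. 0 < z \<and> ereal z \<le> y} \<le> measure \<kappa> {z. 0 < z \<and> s y \<le> \<sigma> z}"
      proof (rule finite_measure_mono)
        show "{z. 0 < z \<and> ereal z \<le> y} \<subseteq> {z. 0 < z \<and> s y \<le> \<sigma> z}"
          using reciprocating_half_antimono[OF half] by (auto simp: \<sigma>_pos)
        show "{z. 0 < z \<and> s y \<le> \<sigma> z} \<in> sets \<kappa>" unfolding \<kappa>(2) using \<sigma>_measurable by measurable
      qed
      then show ?thesis using G_pos[OF that] G_neg[OF reciprocating_half_nonpos[OF half that]] by simp
    qed
    then have "s y \<le> partner y"
      using reciprocating_half_nonpos[OF half that] by (intro partner_greatest)
    moreover have "\<not> s y < partner y"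
    proof
      assume less: "s y < partner y"
      define x where "x = partner y"
      have x: "x \<le> 0" "G \<mu> x = G \<mu> y" "s y < x"
        using partner_nonpos g_partner[OF that] less by (auto simp: x_def)
      obtain z where z: "0 \<le> z" "\<And>y. 0 \<le> y \<Longrightarrow> x \<le> s y \<longleftrightarrow> y \<le> z" using level[OF x(1)] by blast
      have "z < y" using z(2)[OF that] x(3) by (metis leD not_le)
      let ?I = "{v. z < ereal v \<and> ereal v \<le> y}"
      have I: "?I \<in> sets borel" by measurable
      have "x \<le> s z" using z by blast
      then have "s y < s z" using x(3) by (rule less_le_trans[rotated])
      then have "emeasure \<nu> ?I \<noteq> 0" using interval_pos[OF z(1) \<open>z < y\<close>] by simp
      moreover have "?I \<subseteq> {0<..}" using z(1) le_less_trans[of 0 z] by force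
      ultimately have "0 < measure \<kappa> ?I" using I by (intro \<kappa>_pos)
      moreover have "{v. 0 < v \<and> ereal v \<le> y} = {v. 0 < v \<and> ereal v \<le> z} \<union> ?I"
        using \<open>z < y\<close> \<open>?I \<subseteq> {0<..}\<close> by (auto simp: not_le intro: order_trans less_imp_le)
      then have "G \<mu> y = measure \<kappa> {v. 0 < v \<and> ereal v \<le> z} + measure \<kappa> ?I"
        using that by (simp add: G_pos finite_measure_Union \<kappa>(2) disjoint_iff leD)
      ultimately have "G \<mu> z < G \<mu> y" using G_pos[OF z(1)] by simp
      moreover have "{v. 0 < v \<and> x \<le> \<sigma> v} = {v. 0 < v \<and> ereal v \<le> z}"
        using z(2) by (auto simp: \<sigma>_pos)
      then have "G \<mu> x = G \<mu> z" using G_pos[OF z(1)] G_neg[OF x(1)] by simp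
      ultimately show False using x(2) by simp
    qed
    ultimately show ?thesis using reciprocating_fun_nonneg[OF zm na that] by (simp add: order_le_less)
  qed
  then show ?thesis
    using zm na unfolding reciprocating_extension_def by auto
qed

theorem proposition3p32:
  fixes s :: "ereal \<Rightarrow> ereal"
  assumes "\<exists>x\<in>{0..}. s x \<noteq> 0"
  shows "((\<exists>r. reciprocating_extension s r) \<longleftrightarrow> reciprocating_half s) \<and>
         (reciprocating_half s \<longrightarrow> (\<exists>!r. reciprocating_extension s r))"
  using reciprocating_extension_half reciprocating_extension_unique
    reciprocating_extension_exists[OF _ assms] by blast

end
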